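(* For any $m,n\in\mathbb{N}$ and any zero-set $\mathcal{Z}\subseteq R_{m,n}$, we have $\mu(\mathcal{Z})\le 2mn+5$.
   Context: $\mathbb{Z}_+=\{0,1,2,\dots\}$, $\mathbb{N}=\{1,2,\dots\}$. For $a,b\in\mathbb{N}$, $R_{a,b}=([0,a-1]\times[0,b-1])\cap\mathbb{Z}_+^2$. A zero-set is a union $\mathcal{Z}=\bigcup_{(a,b)\in\mathcal{I}}R_{a,b}$ over a finite set $\mathcal{I}\subseteq\mathbb{N}^2$ (possibly $\mathcal{Z}=\emptyset$). For $x\in\mathbb{Z}_+^2$, $L^h(x)$ and $L^v(x)$ denote the horizontal and vertical lines through $x$ in $\mathbb{Z}_+^2$. For $A\subseteq\mathbb{Z}_+^2$, $\mathtt{row}(x,A)=|L^h(x)\cap A|$ and $\mathtt{col}(x,A)=|L^v(x)\cap A|$. The neighborhood growth transformation is $\mathcal{T}(A)=A\cup\{x\notin A:(\mathtt{row}(x,A),\mathtt{col}(x,A))\notin\mathcal{Z}\}$. A set $A$ spans if $\bigcup_{t\ge0}\mathcal{T}^t(A)=\mathbb{Z}_+^2$. Let $\mathcal{A}(\mathcal{Z})$ be the collection of all finite spanning sets; for $A\in\mathcal{A}(\mathcal{Z})$ the spanning time is $\tau(\mathcal{Z},A)=\min\{t\in\mathbb{N}:\mathcal{T}^t(A)=\mathbb{Z}_+^2\}$ (which is finite), and $\mu(\mathcal{Z})=\sup\{\tau(\mathcal{Z},A):A\in\mathcal{A}(\mathcal{Z})\}$. *)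

theory Defs
  imports Complex_Main "HOL-Library.Extended_Nat"
begin

type_synonym point = "nat \<times> nat"

definition rect :: "nat \<Rightarrow> nat \<Rightarrow> point set" where
  "rect a b = {0..<a} \<times> {0..<b}"

definition zero_set :: "point set \<Rightarrow> bool" where
  "zero_set Z \<longleftrightarrow>
     (\<exists>I. finite I \<and> I \<subseteq> {1..} \<times> {1..} \<and> Z = (\<Union>(a, b)\<in>I. rect a b))"

definition hline :: "point \<Rightarrow> point set" where
  "hline x = {y. snd y = snd x}"

definition vline :: "point \<Rightarrow> point set" where
  "vline x = {y. fst y = fst x}"

text \<open>Lines may meet the occupied set in infinitely many points, whereas \<^const>\<open>card\<close>
  is 0 on infinite sets; hence counts take values in the extended naturals.\<close>

definition ecount :: "'a set \<Rightarrow> enat" where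
  "ecount S = (if finite S then enat (card S) else \<infinity>)"

definition row_count :: "point \<Rightarrow> point set \<Rightarrow> enat" where
  "row_count x A = ecount (hline x \<inter> A)"

definition col_count :: "point \<Rightarrow> point set \<Rightarrow> enat" where
  "col_count x A = ecount (vline x \<inter> A)"

text \<open>The zero-set is embedded in pairs of extended naturals, so a pair with an infinite
  entry is never in it.\<close>

definition growth :: "point set \<Rightarrow> point set \<Rightarrow> point set" where
  "growth Z A =
     A \<union> {x. x \<notin> A \<and> (row_count x A, col_count x A) \<notin> map_prod enat enat ` Z}"

definition spans :: "point set \<Rightarrow> point set \<Rightarrow> bool" where
  "spans Z A \<longleftrightarrow> (\<Union>t. (growth Z ^^ t) A) = UNIV"

definition finite_spanning_sets :: "point set \<Rightarrow> point set set" where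
  "finite_spanning_sets Z = {A. finite A \<and> spans Z A}"

text \<open>The infimum of a nonempty set of extended naturals is its minimum; it is \<open>\<infinity>\<close> if the
  whole quadrant is never reached in finitely many steps.\<close>

definition spanning_time :: "point set \<Rightarrow> point set \<Rightarrow> enat" where
  "spanning_time Z A = Inf {enat t | t. t \<ge> 1 \<and> (growth Z ^^ t) A = UNIV}"

definition max_spanning_time :: "point set \<Rightarrow> enat" where
  "max_spanning_time Z = (SUP A\<in>finite_spanning_sets Z. spanning_time Z A)"

end

theory Submission
  imports Defs
begin

text \<open>Let \<open>G\<^sub>t\<close> be the set of points whose counts at time \<open>t\<close> lie outside the zero-set. Seen as a
  bipartite graph between columns and rows it is a threshold graph: the neighbourhoods of the rows
  in \<open>G\<^sub>t\<close> are ordered by inclusion in the same way as their counts. The sets \<open>G\<^sub>t\<close> increase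
  strictly until the quadrant is full. If a row \<open>\<rho>\<close> of degree \<open>a < m\<close> gains a point, then either
  fewer than \<open>n\<close> rows had degree above \<open>a\<close>, and their number grows; or the least of \<open>n\<close> such rows
  has a neighbour outside the row \<open>\<rho>\<close>, and that column, shared by all \<open>n\<close> rows, fills up in the
  next step. If \<open>a \<ge> m\<close>, then the row \<open>\<rho>\<close> fills up. Hence the potential that adds up the
  numbers (capped at \<open>n\<close>) of rows of degree above \<open>a\<close> for \<open>a < m\<close>, of full rows (capped at \<open>n\<close>)
  and of full columns (capped at \<open>m\<close>) grows at each step, and it is at most
  \<open>m n + m + n \<le> 2 m n + 1\<close>.\<close>

section \<open>Counts with values in the extended naturals, and their capped versions\<close>

lemma ecount_mono: "S \<subseteq> T \<Longrightarrow> ecount S \<le> ecount T"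
  by (auto simp: ecount_def card_mono dest: finite_subset)

lemma ecount_psubset:
  assumes "S \<subset> T" "ecount S \<noteq> \<infinity>"
  shows "ecount S < ecount T"
  using assms by (auto simp: ecount_def psubset_card_mono split: if_splits)

lemma ecount_image: "inj_on f S \<Longrightarrow> ecount (f ` S) = ecount S"
  by (simp add: ecount_def card_image finite_image_iff)

lemma obtain_subset_ecount:
  assumes "enat k \<le> ecount S"
  obtains F where "F \<subseteq> S" "finite F" "card F = k"
proof (cases "finite S")
  case True
  with assms have "k \<le> card S" by (simp add: ecount_def)
  then show ?thesis by (meson obtain_subset_with_card_n that)
next
  case False
  then show ?thesis by (meson infinite_arbitrarily_large that)
qed

lemma row_count_eq: "row_count x A = ecount {i. (i, snd x) \<in> A}"
proof -
  have "hline x \<inter> A = (\<lambda>i. (i, snd x)) ` {i. (i, snd x) \<in> A}"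
    by (auto simp: hline_def)
  then show ?thesis by (simp add: row_count_def ecount_image inj_on_def)
qed

lemma col_count_eq: "col_count x A = ecount {j. (fst x, j) \<in> A}"
proof -
  have "vline x \<inter> A = (\<lambda>j. (fst x, j)) ` {j. (fst x, j) \<in> A}"
    by (auto simp: vline_def)
  then show ?thesis by (simp add: col_count_def ecount_image inj_on_def)
qed

lemma row_count_mono: "A \<subseteq> B \<Longrightarrow> row_count x A \<le> row_count x B"
  by (auto simp: row_count_def intro: ecount_mono)

lemma col_count_mono: "A \<subseteq> B \<Longrightarrow> col_count x A \<le> col_count x B"
  by (auto simp: col_count_def intro: ecount_mono)

text \<open>The minimum is at most \<open>enat k\<close>, so \<open>the_enat\<close> never meets
  \<open>\<infinity>\<close>; an infinite set gets the value \<open>k\<close>.\<close>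

definition capcard :: "nat \<Rightarrow> 'a set \<Rightarrow> nat" where
  "capcard k S = the_enat (min (enat k) (ecount S))"

lemma capcard_le: "capcard k S \<le> k"
  by (cases "ecount S") (auto simp: capcard_def min_def)

lemma capcard_mono: "S \<subseteq> T \<Longrightarrow> capcard k S \<le> capcard k T"
  using ecount_mono[of S T]
  by (cases "ecount S"; cases "ecount T") (auto simp: capcard_def min_def)

lemma capcard_strict_mono:
  assumes "S \<subset> T" "\<not> enat k \<le> ecount S"
  shows "capcard k S < capcard k T"
proof -
  have "ecount S \<noteq> \<infinity>" using assms(2) by (metis enat_ord_simps(3))
  with assms(1) have "ecount S < ecount T" by (rule ecount_psubset)
  with assms(2) show ?thesis
    by (cases "ecount S"; cases "ecount T") (auto simp: capcard_def min_def)
qed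

section \<open>Eligible points and their monotonicity\<close>

definition eligible :: "point set \<Rightarrow> point set \<Rightarrow> point set" where
  "eligible Z A = {x. (row_count x A, col_count x A) \<notin> map_prod enat enat ` Z}"

lemma growth_eq: "growth Z A = A \<union> eligible Z A"
  by (auto simp: growth_def eligible_def)

text \<open>All rectangles in the union are anchored at the origin, and an entry below a finite one
  is itself finite.\<close>

lemma zero_set_down:
  assumes "zero_set Z" "(u, v) \<in> map_prod enat enat ` Z" "u' \<le> u" "v' \<le> v"
  shows "(u', v') \<in> map_prod enat enat ` Z"
proof -
  obtain a b where ab: "(a, b) \<in> Z" "u = enat a" "v = enat b" using assms(2) by auto
  then obtain a' b' where "u' = enat a'" "a' \<le> a" "v' = enat b'" "b' \<le> b"
    using assms(3,4) by (metis enat_ile enat_ord_simps(1))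
  moreover from this have "(a', b') \<in> Z"
    using assms(1) ab(1) by (fastforce simp: zero_set_def rect_def)
  ultimately show ?thesis by force
qed

text \<open>Eligibility ignores whether a point is occupied and depends on its two counts alone. So
  different points, at different times, can be compared.\<close>

lemma eligible_upward:
  assumes "zero_set Z" "x \<in> eligible Z A"
    and "row_count x A \<le> row_count y B" "col_count x A \<le> col_count y B"
  shows "y \<in> eligible Z B"
  using assms(2) unfolding eligible_def mem_Collect_eq
  by (rule contrapos_nn) (rule zero_set_down[OF assms(1) _ assms(3,4)])

lemma eligible_mono: "zero_set Z \<Longrightarrow> A \<subseteq> B \<Longrightarrow> eligible Z A \<subseteq> eligible Z B"
  by (meson eligible_upward row_count_mono col_count_mono subsetI)

lemma eligible_if_row_count_ge:
  assumes "Z \<subseteq> rect m n" "enat m \<le> row_count x A"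
  shows "x \<in> eligible Z A"
  using assms by (fastforce simp: eligible_def rect_def)

lemma eligible_if_col_count_ge:
  assumes "Z \<subseteq> rect m n" "enat n \<le> col_count x A"
  shows "x \<in> eligible Z A"
  using assms by (fastforce simp: eligible_def rect_def)

section \<open>The potential and its strict growth\<close>

definition heavy_rows :: "nat \<Rightarrow> point set \<Rightarrow> nat set" where
  "heavy_rows a G = {j. enat a < row_count (0, j) G}"

definition full_rows :: "point set \<Rightarrow> nat set" where
  "full_rows G = {j. \<forall>i. (i, j) \<in> G}"

definition full_cols :: "point set \<Rightarrow> nat set" where
  "full_cols G = {i. \<forall>j. (i, j) \<in> G}"

definition potential :: "nat \<Rightarrow> nat \<Rightarrow> point set \<Rightarrow> nat" where
  "potential m n G =
     (\<Sum>a<m. capcard n (heavy_rows a G)) + capcard n (full_rows G) + capcard m (full_cols G)"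

lemma potential_le: "potential m n G \<le> m * n + m + n"
proof -
  have "(\<Sum>a<m. capcard n (heavy_rows a G)) \<le> m * n"
    using sum_bounded_above[of "{..<m}" "\<lambda>a. capcard n (heavy_rows a G)" n]
    by (simp add: capcard_le)
  then show ?thesis
    using capcard_le[of n "full_rows G"] capcard_le[of m "full_cols G"]
    by (simp add: potential_def)
qed

lemma heavy_rows_mono: "G \<subseteq> H \<Longrightarrow> heavy_rows a G \<subseteq> heavy_rows a H"
  unfolding heavy_rows_def using row_count_mono[of G H] by (auto intro: less_le_trans)

lemma full_rows_mono: "G \<subseteq> H \<Longrightarrow> full_rows G \<subseteq> full_rows H"
  by (auto simp: full_rows_def)

lemma full_cols_mono: "G \<subseteq> H \<Longrightarrow> full_cols G \<subseteq> full_cols H"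
  by (auto simp: full_cols_def)

lemma potential_less:
  assumes "G \<subseteq> H"
    and "(\<exists>a<m. capcard n (heavy_rows a G) < capcard n (heavy_rows a H))
      \<or> capcard n (full_rows G) < capcard n (full_rows H)
      \<or> capcard m (full_cols G) < capcard m (full_cols H)"
  shows "potential m n G < potential m n H"
proof -
  have *: "\<And>a. capcard n (heavy_rows a G) \<le> capcard n (heavy_rows a H)"
    "capcard n (full_rows G) \<le> capcard n (full_rows H)"
    "capcard m (full_cols G) \<le> capcard m (full_cols H)"
    using assms(1) by (simp_all add: capcard_mono heavy_rows_mono full_rows_mono full_cols_mono)
  have sum_le: "(\<Sum>a<m. capcard n (heavy_rows a G)) \<le> (\<Sum>a<m. capcard n (heavy_rows a H))"
    by (intro sum_mono *)
  from assms(2) show ?thesis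
  proof (elim disjE)
    assume "\<exists>a<m. capcard n (heavy_rows a G) < capcard n (heavy_rows a H)"
    then have "(\<Sum>a<m. capcard n (heavy_rows a G)) < (\<Sum>a<m. capcard n (heavy_rows a H))"
      by (intro sum_strict_mono_ex1) (auto intro: *)
    then show ?thesis using *(2,3) by (simp add: potential_def)
  qed (use sum_le *(2,3) in \<open>simp_all add: potential_def\<close>)
qed

lemma potential_eligible_less:
  assumes Z: "zero_set Z" "Z \<subseteq> rect m n" and "n \<ge> 1"
    and neq: "eligible Z (growth Z A) \<noteq> eligible Z A"
    and not_all: "eligible Z (growth Z A) \<noteq> UNIV"
  shows "potential m n (eligible Z A) < potential m n (eligible Z (growth Z A))"
proof -
  define B where "B = growth Z A"
  define G where "G = eligible Z A"
  define H where "H = eligible Z B"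
  have GB: "G \<subseteq> B" by (simp add: B_def G_def growth_eq)
  have GH: "G \<subseteq> H"
    unfolding G_def H_def by (intro eligible_mono Z) (simp add: B_def growth_eq)
  \<comment> \<open>Points of \<open>G\<close> are occupied in \<open>B\<close>, so \<open>m\<close>
    of them in one row make that whole row eligible at the next step.\<close>
  have full_row: "(i, j) \<in> H" if "enat m \<le> row_count (0, j) G" for i j
  proof -
    have "enat m \<le> row_count (i, j) B"
      using that row_count_mono[OF GB, of "(i, j)"] by (simp add: row_count_eq)
    then show ?thesis unfolding H_def using Z(2) by (rule eligible_if_row_count_ge[rotated])
  qed
  have full_col: "(i, j) \<in> H" if "enat n \<le> col_count (i, 0) G" for i j
  proof -
    have "enat n \<le> col_count (i, j) B"
      using that col_count_mono[OF GB, of "(i, j)"] by (simp add: col_count_eq)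
    then show ?thesis unfolding H_def using Z(2) by (rule eligible_if_col_count_ge[rotated])
  qed
  \<comment> \<open>A full row adds a point to every column, so \<open>n\<close> full rows would
    fill all columns of \<open>H\<close>, against \<open>not_all\<close>. Thus the cap on full rows
    is not yet reached; likewise for columns below.\<close>
  have few_rows: "\<not> enat n \<le> ecount (full_rows G)"
  proof
    assume "enat n \<le> ecount (full_rows G)"
    moreover have "ecount (full_rows G) \<le> col_count (i, 0) G" for i
      by (auto simp: full_rows_def col_count_eq intro: ecount_mono)
    ultimately have "enat n \<le> col_count (i, 0) G" for i by (meson order_trans)
    then have "H = UNIV" using full_col by auto
    then show False using not_all by (simp add: H_def B_def)
  qed
  have few_cols: "\<not> enat m \<le> ecount (full_cols G)"
  proof
    assume "enat m \<le> ecount (full_cols G)"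
    moreover have "ecount (full_cols G) \<le> row_count (0, j) G" for j
      by (auto simp: full_cols_def row_count_eq intro: ecount_mono)
    ultimately have "enat m \<le> row_count (0, j) G" for j by (meson order_trans)
    then have "H = UNIV" using full_row by auto
    then show False using not_all by (simp add: H_def B_def)
  qed
  obtain k r where kr: "(k, r) \<in> H" "(k, r) \<notin> G"
    using neq GH by (auto simp: G_def H_def B_def)
  have "(\<exists>a<m. capcard n (heavy_rows a G) < capcard n (heavy_rows a H))
      \<or> capcard n (full_rows G) < capcard n (full_rows H)
      \<or> capcard m (full_cols G) < capcard m (full_cols H)"
  proof (cases "enat m \<le> row_count (0, r) G")
    case True
    then have "full_rows G \<subset> full_rows H"
      using full_row kr full_rows_mono[OF GH] by (auto simp: full_rows_def)
    from capcard_strict_mono[OF this few_rows] show ?thesis by simp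
  next
    case False
    then obtain a where a: "row_count (0, r) G = enat a" "a < m"
      by (cases "row_count (0, r) G") auto
    show ?thesis
    proof (cases "enat n \<le> ecount (heavy_rows a G)")
      case False
      \<comment> \<open>The row \<open>r\<close> has degree exactly \<open>a\<close> in
        \<open>G\<close>, so one new point lifts it above the level \<open>a\<close>. Finiteness of
        the degree makes the increase strict.\<close>
      have "{i. (i, r) \<in> G} \<subset> {i. (i, r) \<in> H}" using kr GH by auto
      then have "row_count (0, r) G < row_count (0, r) H"
        using a(1) ecount_psubset[of "{i. (i, r) \<in> G}"] by (simp add: row_count_eq)
      then have "r \<in> heavy_rows a H" "r \<notin> heavy_rows a G"
        using a(1) by (auto simp: heavy_rows_def)
      then have "heavy_rows a G \<subset> heavy_rows a H" using heavy_rows_mono[OF GH] by blast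
      from capcard_strict_mono[OF this False] show ?thesis using a(2) by blast
    next
      case True
      then obtain S where S: "S \<subseteq> heavy_rows a G" "finite S" "card S = n"
        by (rule obtain_subset_ecount)
      then have "S \<noteq> {}" using \<open>n \<ge> 1\<close> by auto
      \<comment> \<open>The minimum is taken over counts in \<open>A\<close>, since these decide
        eligibility: in a fixed column, if the point of row \<open>s\<close> is eligible, so are
        those of all rows in \<open>S\<close>.\<close>
      then obtain s where s: "s \<in> S" "\<And>j. j \<in> S \<Longrightarrow> row_count (0, s) A \<le> row_count (0, j) A"
        using S(2) ex_is_arg_min_if_finite[of S "\<lambda>j. row_count (0, j) A"]
        by (auto simp: is_arg_min_linorder)
      have "row_count (0, r) G < row_count (0, s) G"
        using s(1) S(1) a(1) by (auto simp: heavy_rows_def)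
      then have "\<not> {i. (i, s) \<in> G} \<subseteq> {i. (i, r) \<in> G}"
        using ecount_mono by (fastforce simp: row_count_eq)
      then obtain i where i: "(i, s) \<in> G" "(i, r) \<notin> G" by blast
      have "j \<in> {j. (i, j) \<in> G}" if "j \<in> S" for j
        using i(1) unfolding mem_Collect_eq G_def
        by (rule eligible_upward[OF Z(1)])
          (use s(2)[OF that] in \<open>simp_all add: row_count_eq col_count_eq\<close>)
      then have "ecount S \<le> ecount {j. (i, j) \<in> G}" by (intro ecount_mono subsetI)
      then have "enat n \<le> col_count (i, 0) G"
        using S(2,3) by (simp add: col_count_eq ecount_def[of S])
      then have "full_cols G \<subset> full_cols H"
        using full_col i(2) full_cols_mono[OF GH] by (auto simp: full_cols_def)
      from capcard_strict_mono[OF this few_cols] show ?thesis by simp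
    qed
  qed
  then show ?thesis using potential_less[OF GH] by (simp add: G_def H_def B_def)
qed

lemma growth_funpow_fixed:
  assumes "growth Z ((growth Z ^^ t) A) = (growth Z ^^ t) A"
  shows "(growth Z ^^ (t + s)) A = (growth Z ^^ t) A"
  by (induction s) (use assms in simp_all)

lemma growth_funpow_mono: "s \<le> t \<Longrightarrow> (growth Z ^^ s) A \<subseteq> (growth Z ^^ t) A"
  by (rule lift_Suc_mono_le) (auto simp: growth_eq)

text \<open>The iterates increase, so a fixed one contains all others and equals their
  union.\<close>

lemma growth_fixed_spans:
  assumes "spans Z A" "growth Z ((growth Z ^^ t) A) = (growth Z ^^ t) A"
  shows "(growth Z ^^ t) A = UNIV"
proof -
  have "(growth Z ^^ s) A \<subseteq> (growth Z ^^ t) A" for s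
    using growth_funpow_mono[of s "t + s" Z A] growth_funpow_fixed[OF assms(2)] by simp
  then show ?thesis using assms(1) unfolding spans_def by blast
qed

lemma growth_funpow_eq_UNIV:
  assumes Z: "zero_set Z" "Z \<subseteq> rect m n" and "n \<ge> 1" and A: "spans Z A"
  shows "(growth Z ^^ (m * n + m + n + 2)) A = UNIV"
proof (rule ccontr)
  define B where "B t = (growth Z ^^ t) A" for t
  \<comment> \<open>This is the bound on the potential plus 2: the induction reaches only time
    \<open>N - 1\<close>, because the eligible set at time \<open>t\<close> is known to be proper
    only through \<open>B (t + 1)\<close>, and \<open>N - 1\<close> must exceed the bound.\<close>
  define N where "N = m * n + m + n + 2"
  assume "\<not> ?thesis"
  then have proper: "B t \<noteq> UNIV" if "t \<le> N" for t
    using growth_funpow_mono[OF that, of Z A] by (auto simp: B_def N_def)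
  have B_Suc: "B (Suc t) = B t \<union> eligible Z (B t)" for t
    by (simp add: B_def growth_eq)
  have "t \<le> potential m n (eligible Z (B t))" if "t + 1 \<le> N" for t
    using that
  proof (induction t)
    case (Suc t)
    have "eligible Z (B (Suc t)) \<noteq> eligible Z (B t)"
    proof
      assume "eligible Z (B (Suc t)) = eligible Z (B t)"
      \<comment> \<open>\<open>B (Suc t)\<close> already contains the eligible set of
        \<open>B t\<close>.\<close>
      then have "growth Z (B (Suc t)) = B (Suc t)" by (auto simp: growth_eq B_Suc)
      then show False
        using growth_fixed_spans[OF A, of "Suc t"] proper[of "Suc t"] Suc.prems
        by (simp add: B_def)
    qed
    moreover have "eligible Z (B (Suc t)) \<noteq> UNIV"
      using proper[of "Suc (Suc t)"] Suc.prems by (auto simp: B_Suc[of "Suc t"])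
    ultimately have "potential m n (eligible Z (B t)) < potential m n (eligible Z (B (Suc t)))"
      using potential_eligible_less[OF Z \<open>n \<ge> 1\<close>, of "B t"] by (simp add: B_def)
    then show ?case using Suc by simp
  qed simp
  from this[of "N - 1"] show False
    using potential_le[of m n "eligible Z (B (N - 1))"] by (simp add: N_def)
qed

theorem theorem1p1:
  fixes m n :: nat and Z :: "(nat \<times> nat) set"
  assumes "m \<ge> 1" and "n \<ge> 1"
    and "zero_set Z" and "Z \<subseteq> rect m n"
  shows "max_spanning_time Z \<le> enat (2 * m * n + 5)"
  unfolding max_spanning_time_def
proof (rule SUP_least)
  fix A assume "A \<in> finite_spanning_sets Z"
  then have "(growth Z ^^ (m * n + m + n + 2)) A = UNIV"
    by (intro growth_funpow_eq_UNIV[OF assms(3,4,2)]) (simp add: finite_spanning_sets_def)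
  then have "spanning_time Z A \<le> enat (m * n + m + n + 2)"
    unfolding spanning_time_def by (intro Inf_lower) force
  also have "m * n + m + n + 2 \<le> 2 * m * n + 5"
  proof -
    \<comment> \<open>With these witnesses the right side exceeds the left by
      \<open>p * q + 2\<close>.\<close>
    obtain p q where "m = Suc p" "n = Suc q" using assms(1,2) by (metis Suc_le_D One_nat_def)
    then show ?thesis by simp
  qed
  finally show "spanning_time Z A \<le> enat (2 * m * n + 5)" by simp
qed

end
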